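(* Let $\mu\in\mathbb{R}$, $\sigma>0$, $\kappa>-1$ and $\alpha\in\{1,2\}$. Let $f$ be the coupled exponential density with location $\mu$, scale $\sigma$ and coupling $\kappa$ if $\alpha=1$, and the coupled Gaussian density with location $\mu$, scale $\sigma$ and coupling $\kappa$ if $\alpha=2$. Let $f_{\kappa\mathrm{avg}}$ be the coupled average uncertainty of $f$ (the coupled average of $f$ with weight given by the coupled density $f^{(\alpha,\kappa)}$). Then $$f_{\kappa\mathrm{avg}}=f(\mu+\sigma).$$
   Context: Notation: $(a)_+=\max(0,a)$. For $\kappa>-1$, $\kappa\neq 0$, and $\alpha>0$ put $\exp_\kappa^{-1/\alpha}(y)=(1+\kappa y)_+^{-\frac{1+\kappa}{\alpha\kappa}}$; for $\kappa=0$ this means its limit $e^{-y/\alpha}$. The coupled exponential ($\alpha=1$) and coupled Gaussian ($\alpha=2$) densities are $$f(x)=\frac{1}{Z}\exp_\kappa^{-1/\alpha}\!\left(\left(\frac{x-\mu}{\sigma}\right)^{\alpha}\right),$$ where for $\alpha=1$ the variable ranges over $x\ge\mu$ (with $f(x)=0$ for $x<\mu$), and for $\alpha=2$ it ranges over $x\in\mathbb{R}$. Here $Z=Z(\kappa,\sigma,\alpha)>0$ is the normalization constant making $\int f(x)\,dx=1$. For $\alpha=1$, $Z=\sigma$. For $\alpha=2$ and $\kappa>0$, $Z=\sigma\sqrt{\pi}\,\Gamma\!\left(\frac{1}{2\kappa}\right)\big/\left(\sqrt{\kappa}\,\Gamma\!\left(\frac{1+\kappa}{2\kappa}\right)\right)$.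 For $\kappa<0$ the density has compact support because of the $(\cdot)_+$. Let $m=\frac{\alpha\kappa}{1+\kappa}$. The coupled density of $f$ is $$f^{(\alpha,\kappa)}(x)=\frac{f(x)^{1+m}}{\int f(y)^{1+m}\,dy},$$ and the coupled average uncertainty of $f$ is, for $\kappa\ne0$, $$f_{\kappa\mathrm{avg}}=\left(\int f^{(\alpha,\kappa)}(x)\,f(x)^{-m}\,dx\right)^{-1/m}=\left(\int f(x)^{1+m}\,dx\right)^{1/m},$$ and for $\kappa=0$ it is the limiting weighted geometric mean $\exp\left(\int f(x)\ln f(x)\,dx\right)$. All integrals involving powers or logarithms of $f$ are over the set $\{x: f(x)>0\}$. *)

theory Defs
  imports "HOL-Analysis.Analysis"
begin

text \<open>
  \<open>coupled_exp \<kappa> a y\<close> is \<open>exp\<^sub>\<kappa>\<close> raised to \<open>-1/a\<close>. The case \<open>\<kappa> = 0\<close> is the limit of the other one.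
  For \<open>-1 < \<kappa> < 0\<close> the exponent is positive, so the convention \<open>0 powr b = 0\<close> gives the right
  value off the support.
\<close>

definition coupled_exp :: "real \<Rightarrow> real \<Rightarrow> real \<Rightarrow> real" where
  "coupled_exp \<kappa> a y =
     (if \<kappa> = 0 then exp (- y / a)
      else (max 0 (1 + \<kappa> * y)) powr (- ((1 + \<kappa>) / (a * \<kappa>))))"

text \<open>
  The parameter \<open>\<alpha>\<close> is a natural number because \<open>(x - \<mu>) / \<sigma>\<close> may be negative in the Gaussian case
  and \<open>powr\<close> is only meaningful for a nonnegative base. Only \<open>\<alpha> = 1\<close> (exponential) and
  \<open>\<alpha> = 2\<close> (Gaussian) are of interest.
\<close>

definition coupled_domain :: "nat \<Rightarrow> real \<Rightarrow> real set" where
  "coupled_domain \<alpha> \<mu> = (if \<alpha> = 1 then {\<mu>..} else UNIV)"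

definition coupled_kernel :: "nat \<Rightarrow> real \<Rightarrow> real \<Rightarrow> real \<Rightarrow> real \<Rightarrow> real" where
  "coupled_kernel \<alpha> \<kappa> \<mu> \<sigma> x = coupled_exp \<kappa> (real \<alpha>) (((x - \<mu>) / \<sigma>) ^ \<alpha>)"

text \<open>The normalization does not depend on \<open>\<mu>\<close>, by translation invariance.\<close>

definition coupled_Z :: "nat \<Rightarrow> real \<Rightarrow> real \<Rightarrow> real \<Rightarrow> real" where
  "coupled_Z \<alpha> \<kappa> \<mu> \<sigma> = (LINT x:coupled_domain \<alpha> \<mu>|lborel. coupled_kernel \<alpha> \<kappa> \<mu> \<sigma> x)"

definition coupled_pdf :: "nat \<Rightarrow> real \<Rightarrow> real \<Rightarrow> real \<Rightarrow> real \<Rightarrow> real" where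
  "coupled_pdf \<alpha> \<kappa> \<mu> \<sigma> x =
     (if x \<in> coupled_domain \<alpha> \<mu>
      then 1 / coupled_Z \<alpha> \<kappa> \<mu> \<sigma> * coupled_kernel \<alpha> \<kappa> \<mu> \<sigma> x
      else 0)"

definition coupled_exponent :: "nat \<Rightarrow> real \<Rightarrow> real" where
  "coupled_exponent \<alpha> \<kappa> = real \<alpha> * \<kappa> / (1 + \<kappa>)"

text \<open>
  The reweighted density of an arbitrary density \<open>f\<close>. As \<open>1 + m\<close> can be negative, the integrals
  below are restricted to the set where \<open>f\<close> is positive.
\<close>

definition coupled_density :: "nat \<Rightarrow> real \<Rightarrow> (real \<Rightarrow> real) \<Rightarrow> real \<Rightarrow> real" where
  "coupled_density \<alpha> \<kappa> f x =
     f x powr (1 + coupled_exponent \<alpha> \<kappa>)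
     / (LINT y:{y. f y > 0}|lborel. f y powr (1 + coupled_exponent \<alpha> \<kappa>))"

definition coupled_avg :: "nat \<Rightarrow> real \<Rightarrow> (real \<Rightarrow> real) \<Rightarrow> real" where
  "coupled_avg \<alpha> \<kappa> f =
     (if \<kappa> = 0 then exp (LINT x:{x. f x > 0}|lborel. f x * ln (f x))
      else (LINT x:{x. f x > 0}|lborel.
              coupled_density \<alpha> \<kappa> f x * f x powr (- coupled_exponent \<alpha> \<kappa>))
           powr (- 1 / coupled_exponent \<alpha> \<kappa>))"

end

theory Submission
  imports Defs "HOL-Real_Asymp.Real_Asymp"
begin

text \<open>
  Put \<open>y = ((x - \<mu>) / \<sigma>) ^ \<alpha>\<close>, so that \<open>y = 1\<close> at \<open>x = \<mu> + \<sigma>\<close>, let \<open>k = coupled_exp \<kappa> \<alpha> y\<close> be the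
  unnormalized density, and let \<open>w = k powr (1 + m)\<close> with \<open>m = \<alpha> \<kappa> / (1 + \<kappa>)\<close>, the unnormalized
  coupled density. The key is the identity \<open>d/dx ((x - \<mu>) * k) = (1 - y) * w\<close>. As \<open>(x - \<mu>) * k\<close>
  vanishes at the ends of the support and at \<open>\<mu>\<close>, integrating it shows that \<open>y\<close> has mean \<open>1\<close> under
  the coupled density, for every \<open>\<kappa>\<close>
  (\<open>escort_kernel_half_line_moments\<close>, \<open>escort_kernel_domain_moments\<close>).

  The theorem is a restatement of this fact. With \<open>W\<close> the integral of \<open>w\<close>, the equation
  \<open>k = (1 + \<kappa> y) * w\<close> (\<open>coupled_exp_eq_escort_kernel\<close>) gives the normalization
  \<open>Z = (1 + \<kappa>) * W\<close>. For \<open>\<kappa> \<noteq> 0\<close> the coupled average is the integral of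
  \<open>f powr (1 + m) = Z powr (- (1 + m)) * w\<close> to the power \<open>1 / m\<close>
  (\<open>coupled_avg_eq_integral_powr\<close>). That integral is \<open>Z powr (- m) / (1 + \<kappa>)\<close>, and its power is
  \<open>(1 + \<kappa>) powr (- 1 / m) / Z\<close>, which is \<open>f\<close> at \<open>y = 1\<close>. For \<open>\<kappa> = 0\<close> the mean of \<open>y\<close> is taken under
  \<open>f\<close> itself, so the mean of \<open>ln f = - y / \<alpha> - ln Z\<close> is the value of \<open>ln f\<close> at \<open>y = 1\<close>.
\<close>

section \<open>The coupled kernel and its escort kernel\<close>

text \<open>
  This is the kernel \<open>k = coupled_exp \<kappa> a\<close> raised to the power \<open>1 + m\<close>, where
  \<open>m = a \<kappa> / (1 + \<kappa>)\<close>: the unnormalized coupled density as a function of the scaled variable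
  \<open>y\<close>. For \<open>\<kappa> = 0\<close> it is \<open>k\<close> itself, as \<open>m = 0\<close>.
\<close>

definition escort_kernel :: "real \<Rightarrow> real \<Rightarrow> real \<Rightarrow> real" where
  "escort_kernel \<kappa> a y =
     (if \<kappa> = 0 then exp (- y / a)
      else (max 0 (1 + \<kappa> * y)) powr (- ((1 + \<kappa>) / (a * \<kappa>)) - 1))"

lemma escort_kernel_nonneg: "0 \<le> escort_kernel \<kappa> a y"
  by (simp add: escort_kernel_def)

lemma escort_kernel_eq_0: "1 + \<kappa> * y \<le> 0 \<Longrightarrow> escort_kernel \<kappa> a y = 0"
  by (auto simp: escort_kernel_def)

text \<open>
  Since \<open>k powr (- m)\<close> equals \<open>1 + \<kappa> y\<close> on the support, \<open>k = k powr (1 + m) * k powr (- m)\<close>.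
  Off the support both sides vanish by \<open>0 powr b = 0\<close>.
\<close>

lemma coupled_exp_eq_escort_kernel:
  "coupled_exp \<kappa> a y = (1 + \<kappa> * y) * escort_kernel \<kappa> a y"
proof (cases "\<kappa> = 0 \<or> 1 + \<kappa> * y \<le> 0")
  case True
  then show ?thesis by (auto simp: coupled_exp_def escort_kernel_def)
next
  case False
  then show ?thesis
    by (simp add: coupled_exp_def escort_kernel_def powr_diff)
qed

lemma coupled_exp_nonneg: "0 \<le> coupled_exp \<kappa> a y"
  by (simp add: coupled_exp_def)

lemma coupled_exp_pos_iff: "0 < coupled_exp \<kappa> a y \<longleftrightarrow> 0 < 1 + \<kappa> * y"
  by (auto simp: coupled_exp_def)

lemma escort_kernel_measurable [measurable]: "escort_kernel \<kappa> a \<in> borel_measurable borel"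
  unfolding escort_kernel_def by measurable

lemma isCont_escort_kernel:
  assumes "1 + \<kappa> * y > 0"
  shows "isCont (escort_kernel \<kappa> a) y"
proof (cases "\<kappa> = 0")
  case True
  then have "escort_kernel \<kappa> a = (\<lambda>y. exp (- y / a))" by (auto simp: escort_kernel_def)
  moreover have "isCont (\<lambda>y. exp (- y / a)) y"
    unfolding divide_inverse by (intro continuous_intros)
  ultimately show ?thesis by simp
next
  case False
  then have "escort_kernel \<kappa> a = (\<lambda>y. max 0 (1 + \<kappa> * y) powr (- ((1 + \<kappa>) / (a * \<kappa>)) - 1))"
    by (auto simp: escort_kernel_def)
  with assms show ?thesis by (auto intro!: continuous_intros)
qed

lemma has_real_derivative_coupled_exp:
  assumes "1 + \<kappa> * y > 0" and "a \<noteq> 0"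
  shows "(coupled_exp \<kappa> a has_real_derivative - ((1 + \<kappa>) / a) * escort_kernel \<kappa> a y) (at y)"
proof (cases "\<kappa> = 0")
  case True
  then have "coupled_exp \<kappa> a = (\<lambda>y. exp (- y / a))" by (auto simp: coupled_exp_def)
  then show ?thesis using True assms
    by (auto simp: escort_kernel_def intro!: derivative_eq_intros)
next
  case False
  let ?q = "- ((1 + \<kappa>) / (a * \<kappa>))"
  have "((\<lambda>y. (1 + \<kappa> * y) powr ?q) has_real_derivative
          - ((1 + \<kappa>) / a) * escort_kernel \<kappa> a y) (at y)"
    using assms False
    by (auto simp: escort_kernel_def intro!: derivative_eq_intros)
  moreover have "\<forall>\<^sub>F z in nhds y. coupled_exp \<kappa> a z = (1 + \<kappa> * z) powr ?q"
  proof -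
    have "\<forall>\<^sub>F z in nhds y. 1 + \<kappa> * z > 0"
    proof (rule order_tendstoD(1))
      show "((\<lambda>z. 1 + \<kappa> * z) \<longlongrightarrow> 1 + \<kappa> * y) (nhds y)"
        by (intro tendsto_add tendsto_mult tendsto_const filterlim_ident)
    qed (fact assms(1))
    then show ?thesis
      by eventually_elim (use False in \<open>simp add: coupled_exp_def\<close>)
  qed
  ultimately show ?thesis
    by (subst DERIV_cong_ev[OF refl _ refl]) auto
qed

text \<open>
  By the chain rule, \<open>u\<close> times the derivative of \<open>k (u ^ \<alpha>)\<close> is \<open>- (1 + \<kappa>) * y * w\<close> with \<open>y = u ^ \<alpha>\<close>
  and \<open>w\<close> the escort kernel; adding \<open>k = (1 + \<kappa> y) * w\<close> cancels \<open>\<kappa>\<close> and leaves \<open>(1 - y) * w\<close>.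
\<close>

lemma has_real_derivative_times_coupled_exp_power:
  fixes u :: real
  assumes "1 + \<kappa> * u ^ \<alpha> > 0" and "\<alpha> > 0"
  shows "((\<lambda>u. u * coupled_exp \<kappa> (real \<alpha>) (u ^ \<alpha>)) has_real_derivative
           (1 - u ^ \<alpha>) * escort_kernel \<kappa> (real \<alpha>) (u ^ \<alpha>)) (at u)"
proof -
  have "((\<lambda>u. coupled_exp \<kappa> (real \<alpha>) (u ^ \<alpha>)) has_real_derivative
          - ((1 + \<kappa>) / \<alpha>) * escort_kernel \<kappa> \<alpha> (u ^ \<alpha>) * (real \<alpha> * u ^ (\<alpha> - 1))) (at u)"
    using assms by (intro DERIV_chain2[OF has_real_derivative_coupled_exp]) 
      (auto intro!: derivative_eq_intros)
  also have "- ((1 + \<kappa>) / \<alpha>) * escort_kernel \<kappa> \<alpha> (u ^ \<alpha>) * (real \<alpha> * u ^ (\<alpha> - 1))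
      = - (1 + \<kappa>) * escort_kernel \<kappa> \<alpha> (u ^ \<alpha>) * u ^ (\<alpha> - 1)"
  proof -
    have cancel: "- (c / r) * e * (r * v) = - c * e * v" if "r \<noteq> 0" for c r e v :: real
      using that by simp
    show ?thesis by (rule cancel) (use assms in simp)
  qed
  finally have "((\<lambda>u. coupled_exp \<kappa> (real \<alpha>) (u ^ \<alpha>)) has_real_derivative
      - (1 + \<kappa>) * escort_kernel \<kappa> \<alpha> (u ^ \<alpha>) * u ^ (\<alpha> - 1)) (at u)" .
  from DERIV_mult[OF DERIV_ident this]
  have "((\<lambda>u. u * coupled_exp \<kappa> (real \<alpha>) (u ^ \<alpha>)) has_real_derivative
      coupled_exp \<kappa> \<alpha> (u ^ \<alpha>) - (1 + \<kappa>) * escort_kernel \<kappa> \<alpha> (u ^ \<alpha>) * (u * u ^ (\<alpha> - 1))) (at u)"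
    by (simp add: algebra_simps)
  also have "u * u ^ (\<alpha> - 1) = u ^ \<alpha>"
    using assms by (cases \<alpha>) auto
  finally show ?thesis
    by (simp add: coupled_exp_eq_escort_kernel algebra_simps)
qed

section \<open>The scaled variable has escort mean one\<close>

text \<open>
  An extended real, so that the compact supports (\<open>\<kappa> < 0\<close>) and the unbounded ones (\<open>\<kappa> \<ge> 0\<close>) are
  covered by the same application of the fundamental theorem of calculus.
\<close>

definition support_end :: "nat \<Rightarrow> real \<Rightarrow> ereal" where
  "support_end \<alpha> \<kappa> = (if \<kappa> \<ge> 0 then \<infinity> else ereal (root \<alpha> (- 1 / \<kappa>)))"

lemma less_support_end_iff:
  fixes u :: real
  assumes "\<alpha> > 0" and "u \<ge> 0"
  shows "ereal u < support_end \<alpha> \<kappa> \<longleftrightarrow> 1 + \<kappa> * u ^ \<alpha> > 0"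
proof (cases "\<kappa> \<ge> 0")
  case True
  with assms have "\<kappa> * u ^ \<alpha> \<ge> 0" by simp
  with True show ?thesis by (simp add: support_end_def)
next
  case False
  have "u < root \<alpha> (- 1 / \<kappa>) \<longleftrightarrow> u ^ \<alpha> < - 1 / \<kappa>"
    using assms real_root_less_iff[of \<alpha> "u ^ \<alpha>" "- 1 / \<kappa>"] by (simp add: real_root_power_cancel)
  also have "\<dots> \<longleftrightarrow> 1 + \<kappa> * u ^ \<alpha> > 0"
    using False by (simp add: field_simps) linarith
  finally show ?thesis using False by (simp add: support_end_def)
qed

text \<open>
  The boundary term of the integration by parts. The decay is exponential for \<open>\<kappa> = 0\<close>. For \<open>\<kappa> > 0\<close> the function decays like
  \<open>u powr (- 1 / \<kappa>)\<close>; for \<open>\<kappa> < 0\<close> the exponent \<open>- (1 + \<kappa>) / (\<alpha> \<kappa>)\<close> is positive, so the kernel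
  tends to \<open>0\<close> at the edge of its support.
\<close>

lemma times_coupled_exp_power_tendsto_0:
  assumes "\<alpha> > 0" and "\<kappa> > -1"
  shows "(((\<lambda>u. u * coupled_exp \<kappa> (real \<alpha>) (u ^ \<alpha>)) \<circ> real_of_ereal) \<longlongrightarrow> 0)
           (at_left (support_end \<alpha> \<kappa>))"
proof -
  let ?H = "\<lambda>u. u * coupled_exp \<kappa> (real \<alpha>) (u ^ \<alpha>)"
  consider "\<kappa> = 0" | "\<kappa> > 0" | "\<kappa> < 0" by linarith
  then show ?thesis
  proof cases
    case 1
    have "((\<lambda>u::real. u * exp (- (u powr real \<alpha>) / real \<alpha>)) \<longlongrightarrow> 0) at_top"
      using assms by real_asymp
    then have "(?H \<longlongrightarrow> 0) at_top"
      by (rule Lim_transform_eventually)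
         (use eventually_gt_at_top[of 0] in eventually_elim,
           simp add: 1 coupled_exp_def powr_realpow)
    then show ?thesis using 1 by (simp add: support_end_def ereal_tendsto_simps)
  next
    case 2
    have "((\<lambda>u::real. u * (1 + \<kappa> * u powr real \<alpha>) powr (- ((1 + \<kappa>) / (real \<alpha> * \<kappa>)))) \<longlongrightarrow> 0) at_top"
      using assms 2 by real_asymp
    then have "(?H \<longlongrightarrow> 0) at_top"
      by (rule Lim_transform_eventually)
         (use eventually_gt_at_top[of 0] in eventually_elim,
           use 2 in \<open>simp add: coupled_exp_def powr_realpow\<close>)
    then show ?thesis using 2 by (simp add: support_end_def ereal_tendsto_simps)
  next
    case 3
    define c where "c = root \<alpha> (- 1 / \<kappa>)"
    have c: "c ^ \<alpha> = - 1 / \<kappa>"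
      unfolding c_def using 3 assms by (intro real_root_pow_pos2) (auto simp: divide_simps)
    have "((\<lambda>u. max 0 (1 + \<kappa> * u ^ \<alpha>)) \<longlongrightarrow> max 0 (1 + \<kappa> * c ^ \<alpha>)) (at_left c)"
      by (intro tendsto_intros)
    then have "((\<lambda>u. max 0 (1 + \<kappa> * u ^ \<alpha>)) \<longlongrightarrow> 0) (at_left c)"
      using c 3 by simp
    moreover have "- ((1 + \<kappa>) / (\<alpha> * \<kappa>)) > 0"
      using assms 3 by (simp add: divide_pos_neg mult_pos_neg)
    ultimately have "((\<lambda>u. max 0 (1 + \<kappa> * u ^ \<alpha>) powr (- ((1 + \<kappa>) / (\<alpha> * \<kappa>)))) \<longlongrightarrow> 0) (at_left c)"
      by (intro tendsto_zero_powrI[OF _ tendsto_const]) auto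
    then have "(?H \<longlongrightarrow> c * 0) (at_left c)"
      using 3 by (intro tendsto_mult tendsto_ident_at) (simp add: coupled_exp_def)
    then show ?thesis using 3 by (simp add: support_end_def ereal_tendsto_simps c_def)
  qed
qed


text \<open>
  The scaled variable \<open>y = u ^ \<alpha>\<close> has mean \<open>1\<close> under the escort weight \<open>w\<close>, because \<open>(1 - y) * w\<close> is
  the derivative of \<open>H u = u * k (u ^ \<alpha>)\<close>, which vanishes at both ends.

  That derivative changes sign only at \<open>u = 1\<close>, so the fundamental theorem for functions of
  constant sign applies on either side of \<open>1\<close> and yields integrability along with the value. This
  includes the case \<open>\<kappa> < 0\<close>, where \<open>w\<close> may be unbounded at the edge of the support. For \<open>u\<close> bounded
  away from \<open>1\<close> on the right, the integrable function \<open>\<bar>1 - y\<bar> * w\<close> dominates a positive multiple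
  of \<open>w\<close>, which makes \<open>w\<close> itself integrable.
\<close>

lemma escort_kernel_half_line_moments:
  fixes \<alpha> :: nat and \<kappa> :: real
  assumes "\<alpha> > 0" and "\<kappa> > -1"
  obtains J where "J > 0"
    and "has_bochner_integral lborel (\<lambda>u. indicator {0..} u * escort_kernel \<kappa> \<alpha> (u ^ \<alpha>)) J"
    and "has_bochner_integral lborel (\<lambda>u. indicator {0..} u * (u ^ \<alpha> * escort_kernel \<kappa> \<alpha> (u ^ \<alpha>))) J"
proof -
  define W where "W u = escort_kernel \<kappa> \<alpha> (u ^ \<alpha>)" for u
  define h where "h u = (1 - u ^ \<alpha>) * W u" for u
  define H where "H u = u * coupled_exp \<kappa> \<alpha> (u ^ \<alpha>)" for u
  define b where "b = support_end \<alpha> \<kappa>"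
  have [measurable]: "W \<in> borel_measurable borel" unfolding W_def by measurable
  have W_nonneg: "W u \<ge> 0" for u by (simp add: W_def escort_kernel_nonneg)
  have b_iff: "ereal u < b \<longleftrightarrow> 1 + \<kappa> * u ^ \<alpha> > 0" if "u \<ge> 0" for u
    using that assms by (simp add: b_def less_support_end_iff)
  have b_gt1: "1 < b" using b_iff[of 1] assms by (simp add: one_ereal_def)
  have lt_b: "ereal u < b" if "u \<le> 1" for u
    using that b_gt1 by (metis ereal_less_eq(3) le_less_trans one_ereal_def)
  have W_0: "W u = 0" if "u \<ge> 0" "\<not> ereal u < b" for u
    using that by (simp add: W_def b_iff escort_kernel_eq_0)
  have deriv: "DERIV H u :> h u" if "u \<ge> 0" "ereal u < b" for u
    using that assms b_iff[of u] has_real_derivative_times_coupled_exp_power[of \<kappa> u \<alpha>]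
    unfolding H_def h_def W_def by simp
  have contW: "isCont W u" if "u \<ge> 0" "ereal u < b" for u
  proof -
    have "isCont (escort_kernel \<kappa> \<alpha>) (u ^ \<alpha>)"
      using that b_iff[of u] by (intro isCont_escort_kernel) simp
    then show ?thesis
      unfolding W_def by (rule isCont_o2[rotated]) (intro continuous_intros)
  qed
  have conth: "isCont h u" if "u \<ge> 0" "ereal u < b" for u
    unfolding h_def using contW[OF that] by (intro continuous_intros)
  have contH: "isCont H u" if "u \<ge> 0" "ereal u < b" for u
    using deriv[OF that] by (rule DERIV_isCont)
  have in01: "0 \<le> u \<and> u \<le> 1 \<and> ereal u < b" if "0 < ereal u" "ereal u < 1" for u
    using that lt_b[of u] by (auto simp: zero_ereal_def one_ereal_def)
  have H_at_0: "((H \<circ> real_of_ereal) \<longlongrightarrow> 0) (at_right 0)"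
  proof -
    have "isCont H 0" using lt_b[of 0] by (intro contH) auto
    then have "(H \<longlongrightarrow> H 0) (at_right 0)" by (auto simp: continuous_within intro: tendsto_within_subset)
    then show ?thesis unfolding zero_ereal_def by (simp add: ereal_tendsto_simps H_def)
  qed
  have cH1: "isCont H 1" using lt_b[of 1] by (intro contH) auto
  have H_at_1l: "((H \<circ> real_of_ereal) \<longlongrightarrow> H 1) (at_left 1)"
    and H_at_1r: "((H \<circ> real_of_ereal) \<longlongrightarrow> H 1) (at_right 1)"
    using cH1 unfolding one_ereal_def
    by (auto simp: ereal_tendsto_simps continuous_within intro: tendsto_within_subset)
  have H_at_b: "((H \<circ> real_of_ereal) \<longlongrightarrow> 0) (at_left b)"
    using times_coupled_exp_power_tendsto_0[OF assms] by (simp add: H_def[abs_def] b_def)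
  have int1: "set_integrable lborel (einterval 0 1) h" "(LBINT x=0..1. h x) = H 1 - 0"
    by (rule interval_integral_FTC_nonneg[of 0 1 H h 0 "H 1"];
        use in01 deriv conth H_at_0 H_at_1l W_nonneg in \<open>force simp: h_def power_le_one\<close>)+
  have ge1: "u \<ge> 1" if "1 < ereal u" for u using that by (simp add: one_ereal_def)
  have int2: "set_integrable lborel (einterval 1 b) (\<lambda>u. - h u)"
      "(LBINT x=1..b. - h x) = - 0 - - H 1"
  proof -
    have D: "DERIV (\<lambda>u. - H u) u :> - h u" if "1 < ereal u" "ereal u < b" for u
      using deriv[of u] ge1[of u] that by (intro DERIV_minus) auto
    have C: "isCont (\<lambda>u. - h u) u" if "1 < ereal u" "ereal u < b" for u
      using conth[of u] ge1[of u] that by (intro continuous_minus) auto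
    have N: "AE x in lborel. 1 < ereal x \<longrightarrow> ereal x < b \<longrightarrow> 0 \<le> - h x"
      using ge1 W_nonneg by (auto simp: h_def mult_le_0_iff one_le_power)
    have A: "(((\<lambda>u. - H u) \<circ> real_of_ereal) \<longlongrightarrow> - H 1) (at_right 1)"
      using tendsto_minus[OF H_at_1r] by (simp add: o_def)
    have B: "(((\<lambda>u. - H u) \<circ> real_of_ereal) \<longlongrightarrow> - 0) (at_left b)"
      using tendsto_minus[OF H_at_b] by (simp add: o_def)
    show "set_integrable lborel (einterval 1 b) (\<lambda>u. - h u)"
      "(LBINT x=1..b. - h x) = - 0 - - H 1"
      using interval_integral_FTC_nonneg[OF b_gt1 D C N A B] by simp_all
  qed
  have h1: "has_bochner_integral lborel (\<lambda>u. indicator (einterval 0 1) u * h u) (H 1)"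
    using int1 by (simp add: has_bochner_integral_iff set_integrable_def interval_lebesgue_integral_def
        set_lebesgue_integral_def)
  have h2: "has_bochner_integral lborel (\<lambda>u. indicator (einterval 1 b) u * - h u) (H 1)"
    using int2 less_imp_le[OF b_gt1] by (simp add: has_bochner_integral_iff set_integrable_def interval_lebesgue_integral_def
        set_lebesgue_integral_def)
  have h12: "has_bochner_integral lborel
      (\<lambda>u. indicator (einterval 0 1) u * h u - indicator (einterval 1 b) u * - h u) 0"
    using has_bochner_integral_diff[OF h1 h2] by simp
  have h_total: "has_bochner_integral lborel (\<lambda>u. indicator {0..} u * h u) 0"
  proof (rule has_bochner_integral_discrete_difference[where X = "{0}", THEN iffD1, OF _ _ _ _ h12])
    fix u :: real assume "u \<notin> {0}"
    then show "indicator (einterval 0 1) u * h u - indicator (einterval 1 b) u * - h u = indicator {0..} u * h u"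
      using W_0[of u] b_gt1
      by (cases "u = 1") (auto simp: einterval_iff h_def zero_ereal_def one_ereal_def split: split_indicator)
  qed auto
  \<comment> \<open>A point \<open>a\<close> inside the support separates a compact part, on which \<open>W\<close> is continuous, from a
    tail, on which \<open>W \<le> \<bar>h\<bar> / (a ^ \<alpha> - 1)\<close>.\<close>
  obtain a where a: "1 < a" "ereal a < b"
  proof -
    obtain a where "1 < ereal a" "ereal a < b" using ereal_dense2[OF b_gt1] by blast
    then show ?thesis using that by (simp add: one_ereal_def)
  qed
  have "set_integrable lborel {0..a} W"
  proof (intro borel_integrable_atLeastAtMost' continuous_at_imp_continuous_on ballI contW)
    fix u assume u: "u \<in> {0..a}"
    then show "u \<ge> 0" by simp
    have "ereal u \<le> ereal a" using u by simp
    then show "ereal u < b" using a(2) by (rule le_less_trans)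
  qed
  then have Wa: "integrable lborel (\<lambda>u. indicator {0..a} u * W u)"
    by (simp add: set_integrable_def)
  have ha: "integrable lborel (\<lambda>u. indicator {0..} u * h u)"
    using h_total by (simp add: has_bochner_integral_iff)
  have a_pow: "a ^ \<alpha> > 1" using a assms by (simp add: one_less_power)
  have intW: "integrable lborel (\<lambda>u. indicator {0..} u * W u)"
  proof (rule Bochner_Integration.integrable_bound)
    show "integrable lborel (\<lambda>u. \<bar>indicator {0..a} u * W u\<bar> + 1 / (a ^ \<alpha> - 1) * \<bar>indicator {0..} u * h u\<bar>)"
      using Wa ha by (intro Bochner_Integration.integrable_add integrable_abs integrable_mult_right)
    show "AE u in lborel. norm (indicator {0..} u * W u)
        \<le> norm (\<bar>indicator {0..a} u * W u\<bar> + 1 / (a ^ \<alpha> - 1) * \<bar>indicator {0..} u * h u\<bar>)"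
    proof (rule AE_I2)
      fix u :: real
      have "W u \<le> 1 / (a ^ \<alpha> - 1) * \<bar>h u\<bar>" if "u > a"
      proof -
        have "a ^ \<alpha> \<le> u ^ \<alpha>" using that a by (intro power_mono) auto
        then have "(a ^ \<alpha> - 1) * W u \<le> \<bar>h u\<bar>"
          using W_nonneg[of u] a_pow by (simp add: h_def abs_mult mult_right_mono)
        then show ?thesis using a_pow by (simp add: field_simps)
      qed
      then show "norm (indicator {0..} u * W u)
        \<le> norm (\<bar>indicator {0..a} u * W u\<bar> + 1 / (a ^ \<alpha> - 1) * \<bar>indicator {0..} u * h u\<bar>)"
        using W_nonneg[of u] a_pow by (auto split: split_indicator)
    qed
  qed simp
  define J where "J = (LINT u|lborel. indicator {0..} u * W u)"
  have J: "has_bochner_integral lborel (\<lambda>u. indicator {0..} u * W u) J"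
    using intW by (simp add: has_bochner_integral_iff J_def)
  have "has_bochner_integral lborel (\<lambda>u. indicator {0..} u * W u - indicator {0..} u * h u) (J - 0)"
    using J h_total by (rule has_bochner_integral_diff)
  then have J2: "has_bochner_integral lborel (\<lambda>u. indicator {0..} u * (u ^ \<alpha> * W u)) J"
    by (simp add: h_def algebra_simps)
  \<comment> \<open>\<open>H 1\<close> is the integral of \<open>h \<le> W\<close> over \<open>(0, 1)\<close>, a positive lower bound for \<open>J\<close>.\<close>
  have "0 < H 1" using assms by (simp add: H_def coupled_exp_pos_iff)
  also have "H 1 \<le> J"
    unfolding has_bochner_integral_integral_eq[OF h1, symmetric] has_bochner_integral_integral_eq[OF J, symmetric]
  proof (rule integral_mono)
    show "integrable lborel (\<lambda>u. indicator (einterval 0 1) u * h u)"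
      "integrable lborel (\<lambda>u. indicator {0..} u * W u)"
      using h1 J by (simp_all only: has_bochner_integral_iff)
    fix u :: real
    show "indicator (einterval 0 1) u * h u \<le> indicator {0..} u * W u"
      using W_nonneg[of u] by (auto simp: h_def einterval_iff zero_ereal_def algebra_simps split: split_indicator)
  qed
  finally show ?thesis using that J J2 by (simp add: W_def)
qed

section \<open>From the half-line to the domain of the density\<close>

text \<open>
  The factor \<open>\<sigma>\<close> is the Jacobian of \<open>u = (x - \<mu>) / \<sigma>\<close>. The factor \<open>\<alpha>\<close> counts half-lines: the domain
  is one of them for \<open>\<alpha> = 1\<close>, and for \<open>\<alpha> = 2\<close> it is the whole line and the integrand is even in \<open>u\<close>.
\<close>

lemma lift_half_line_integral:
  assumes half: "has_bochner_integral lborel (\<lambda>u. indicator {0..} u * g (u ^ \<alpha>)) J"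
    and "\<sigma> > 0" and "\<alpha> \<in> {1, 2}"
  shows "has_bochner_integral lborel
    (\<lambda>x. indicator (coupled_domain \<alpha> \<mu>) x * g (((x - \<mu>) / \<sigma>) ^ \<alpha>)) (\<sigma> * (real \<alpha> * J :: real))"
proof -
  have "has_bochner_integral lborel (\<lambda>u. indicator (coupled_domain \<alpha> 0) u * g (u ^ \<alpha>)) (real \<alpha> * J)"
  proof (cases "\<alpha> = 1")
    case True
    with half show ?thesis by (simp add: coupled_domain_def)
  next
    case False
    with assms have \<alpha>: "\<alpha> = 2" by simp
    from has_bochner_integral_even_function[of "\<lambda>u. g (u ^ \<alpha>)" J] half \<alpha> show ?thesis
      by (simp add: coupled_domain_def)
  qed
  then have "has_bochner_integral lborel
      (\<lambda>x. indicator (coupled_domain \<alpha> 0) (- \<mu> / \<sigma> + 1 / \<sigma> * x) * g ((- \<mu> / \<sigma> + 1 / \<sigma> * x) ^ \<alpha>))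
      ((real \<alpha> * J) /\<^sub>R \<bar>1 / \<sigma>\<bar>)"
    using assms by (subst (asm) lborel_has_bochner_integral_real_affine_iff[where c = "1 / \<sigma>" and t = "- \<mu> / \<sigma>"]) auto
  moreover have "indicator (coupled_domain \<alpha> 0) (- \<mu> / \<sigma> + 1 / \<sigma> * x) = (indicator (coupled_domain \<alpha> \<mu>) x :: real)" for x
    using assms by (auto simp: coupled_domain_def field_simps split: split_indicator)
  moreover have "- \<mu> / \<sigma> + 1 / \<sigma> * x = (x - \<mu>) / \<sigma>" for x
    by (simp add: diff_divide_distrib)
  ultimately show ?thesis using assms by simp
qed

lemma escort_kernel_domain_moments:
  assumes "\<sigma> > 0" and "\<kappa> > -1" and "\<alpha> \<in> {1, 2}"
  obtains W where "W > 0"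
    and "has_bochner_integral lborel
          (\<lambda>x. indicator (coupled_domain \<alpha> \<mu>) x * escort_kernel \<kappa> \<alpha> (((x - \<mu>) / \<sigma>) ^ \<alpha>)) W"
    and "has_bochner_integral lborel
          (\<lambda>x. indicator (coupled_domain \<alpha> \<mu>) x *
                 (((x - \<mu>) / \<sigma>) ^ \<alpha> * escort_kernel \<kappa> \<alpha> (((x - \<mu>) / \<sigma>) ^ \<alpha>))) W"
proof -
  have "\<alpha> > 0" using assms by auto
  then obtain J where "J > 0"
    and J: "has_bochner_integral lborel (\<lambda>u. indicator {0..} u * escort_kernel \<kappa> \<alpha> (u ^ \<alpha>)) J"
      "has_bochner_integral lborel (\<lambda>u. indicator {0..} u * (u ^ \<alpha> * escort_kernel \<kappa> \<alpha> (u ^ \<alpha>))) J"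
    using escort_kernel_half_line_moments assms(2) by blast
  show ?thesis
  proof (rule that)
    show "\<sigma> * (real \<alpha> * J) > 0" using assms \<open>\<alpha> > 0\<close> \<open>J > 0\<close> by simp
  qed (use assms lift_half_line_integral[OF J(1)]
      lift_half_line_integral[where g = "\<lambda>y. y * escort_kernel \<kappa> \<alpha> y", OF J(2)] in auto)
qed

section \<open>The coupled average\<close>

text \<open>
  Reweighting by \<open>f powr (1 + m)\<close> and averaging \<open>f powr (- m)\<close> leaves \<open>f\<close> itself in the numerator,
  whose integral is \<open>1\<close>; only the normalization of the coupled density survives.
\<close>

lemma coupled_avg_eq_integral_powr:
  assumes \<kappa>: "\<kappa> \<noteq> 0"
    and nonneg: "\<And>x. f x \<ge> 0"
    and norm: "(LINT x|lborel. f x) = 1"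
    and pos: "(LINT x:{x. f x > 0}|lborel. f x powr (1 + coupled_exponent \<alpha> \<kappa>)) > 0"
  shows "coupled_avg \<alpha> \<kappa> f =
    (LINT x:{x. f x > 0}|lborel. f x powr (1 + coupled_exponent \<alpha> \<kappa>)) powr (1 / coupled_exponent \<alpha> \<kappa>)"
proof -
  define m where "m = coupled_exponent \<alpha> \<kappa>"
  define I where "I = (LINT x:{x. f x > 0}|lborel. f x powr (1 + m))"
  have "indicator {x. f x > 0} x *\<^sub>R (coupled_density \<alpha> \<kappa> f x * f x powr - m) = f x / I" for x
  proof (cases "f x > 0")
    case True
    then have "f x powr (1 + m) * f x powr - m = f x"
      by (simp flip: powr_add)
    with True show ?thesis
      by (simp add: coupled_density_def I_def m_def)
  next
    case False
    with nonneg[of x] show ?thesis by simp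
  qed
  then have "(LINT x:{x. f x > 0}|lborel. coupled_density \<alpha> \<kappa> f x * f x powr - m) = 1 / I"
    using norm by (simp add: set_lebesgue_integral_def)
  moreover have "(1 / I) powr (- 1 / m) = I powr (1 / m)"
    using pos by (simp add: I_def m_def powr_divide powr_minus_divide)
  ultimately show ?thesis
    using \<kappa> by (simp add: coupled_avg_def I_def m_def)
qed

theorem theorem1:
  fixes \<mu> \<sigma> \<kappa> :: real and \<alpha> :: nat
  assumes "\<sigma> > 0" and "\<kappa> > -1" and "\<alpha> \<in> {1, 2}"
  shows "coupled_avg \<alpha> \<kappa> (coupled_pdf \<alpha> \<kappa> \<mu> \<sigma>) = coupled_pdf \<alpha> \<kappa> \<mu> \<sigma> (\<mu> + \<sigma>)"
proof -
  define D where "D = coupled_domain \<alpha> \<mu>"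
  define y where "y x = ((x - \<mu>) / \<sigma>) ^ \<alpha>" for x
  define w where "w x = escort_kernel \<kappa> \<alpha> (y x)" for x
  define k where "k x = coupled_kernel \<alpha> \<kappa> \<mu> \<sigma> x" for x
  define Z where "Z = coupled_Z \<alpha> \<kappa> \<mu> \<sigma>"
  define f where "f = coupled_pdf \<alpha> \<kappa> \<mu> \<sigma>"
  obtain W where W: "W > 0"
    and w_int: "has_bochner_integral lborel (\<lambda>x. indicator D x * w x) W"
    and yw_int: "has_bochner_integral lborel (\<lambda>x. indicator D x * (y x * w x)) W"
    unfolding w_def y_def D_def using escort_kernel_domain_moments[OF assms] by blast
  have k_eq: "k x = (1 + \<kappa> * y x) * w x" for x
    by (simp add: k_def w_def y_def coupled_kernel_def coupled_exp_eq_escort_kernel)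
  have k_pos: "k x > 0 \<longleftrightarrow> 1 + \<kappa> * y x > 0" and k_nonneg: "k x \<ge> 0" for x
    by (simp_all add: k_def y_def coupled_kernel_def coupled_exp_pos_iff coupled_exp_nonneg)
  have "has_bochner_integral lborel
      (\<lambda>x. indicator D x * w x + \<kappa> * (indicator D x * (y x * w x))) (W + \<kappa> * W)"
    using w_int yw_int by (intro has_bochner_integral_add has_bochner_integral_mult_right) auto
  then have k_int: "has_bochner_integral lborel (\<lambda>x. indicator D x * k x) ((1 + \<kappa>) * W)"
    by (simp add: k_eq algebra_simps)
  \<comment> \<open>This is where the mean of \<open>y\<close> being \<open>1\<close> enters: \<open>k = (1 + \<kappa> y) * w\<close> integrates to \<open>(1 + \<kappa>) * W\<close>.\<close>
  have Z_eq: "Z = (1 + \<kappa>) * W"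
    using k_int by (simp add: Z_def coupled_Z_def set_lebesgue_integral_def D_def k_def has_bochner_integral_iff)
  have Z: "Z > 0" using W assms by (simp add: Z_eq)
  have f_eq: "f x = indicator D x * k x / Z" for x
    by (simp add: f_def coupled_pdf_def D_def k_def Z_def)
  have f_nonneg: "f x \<ge> 0" for x
    using Z k_nonneg by (simp add: f_eq)
  have f_pos: "f x > 0 \<longleftrightarrow> x \<in> D \<and> 1 + \<kappa> * y x > 0" for x
    using Z by (auto simp: f_eq k_pos[symmetric] zero_less_divide_iff split: split_indicator)
  have f_int: "has_bochner_integral lborel f 1"
  proof -
    have "has_bochner_integral lborel (\<lambda>x. indicator D x * k x / Z) ((1 + \<kappa>) * W / Z)"
      using k_int by (rule has_bochner_integral_divide_zero)
    moreover have "(1 + \<kappa>) * W / Z = 1" using Z by (simp flip: Z_eq)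
    ultimately show ?thesis by (simp only: f_eq[abs_def])
  qed
  have y_at: "y (\<mu> + \<sigma>) = 1" using assms by (simp add: y_def)
  have "\<mu> + \<sigma> \<in> D" using assms by (simp add: D_def coupled_domain_def)
  then have f_at: "f (\<mu> + \<sigma>) = coupled_exp \<kappa> \<alpha> 1 / Z"
    using y_at by (simp add: f_eq k_def coupled_kernel_def y_def)
  have "coupled_avg \<alpha> \<kappa> f = f (\<mu> + \<sigma>)"
  proof (cases "\<kappa> = 0")
    case True
    \<comment> \<open>\<open>ln f = - y / \<alpha> - ln Z\<close>, so the entropy is determined by the first moment of \<open>y\<close>.\<close>
    have "indicator {x. f x > 0} x *\<^sub>R (f x * ln (f x))
        = - (1 / (real \<alpha> * Z)) * (indicator D x * (y x * w x)) - ln Z * f x" for x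
    proof (cases "x \<in> D")
      case True
      have w: "w x = exp (- y x / \<alpha>)"
        using \<open>\<kappa> = 0\<close> by (simp add: w_def escort_kernel_def)
      have fx: "f x = w x / Z"
        using \<open>\<kappa> = 0\<close> True by (simp add: f_eq k_eq)
      have "f x > 0" and "ln (f x) = - y x / \<alpha> - ln Z"
        using Z w fx by (simp_all add: ln_div)
      then have "indicator {x. f x > 0} x *\<^sub>R (f x * ln (f x)) = w x / Z * (- y x / \<alpha> - ln Z)"
        using fx by simp
      also have "\<dots> = - (1 / (real \<alpha> * Z)) * (y x * w x) - ln Z * (w x / Z)"
        by (simp add: algebra_simps)
      finally show ?thesis using True fx by simp
    next
      case False
      then show ?thesis by (simp add: f_eq)
    qed
    moreover have "has_bochner_integral lborel
      (\<lambda>x. - (1 / (real \<alpha> * Z)) * (indicator D x * (y x * w x)) - ln Z * f x)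
      (- (1 / (real \<alpha> * Z)) * W - ln Z * 1)"
      using yw_int f_int by (intro has_bochner_integral_diff has_bochner_integral_mult_right) auto
    ultimately have "(LINT x:{x. f x > 0}|lborel. f x * ln (f x)) = - (1 / (real \<alpha> * Z)) * W - ln Z * 1"
      by (simp add: set_lebesgue_integral_def has_bochner_integral_iff)
    also have "\<dots> = - 1 / \<alpha> - ln Z"
      using True W assms by (simp add: Z_eq)
    finally show ?thesis
      using True Z by (simp add: coupled_avg_def f_at coupled_exp_def exp_diff)
  next
    case False
    define m where "m = coupled_exponent \<alpha> \<kappa>"
    have m: "m \<noteq> 0" "1 / m = (1 + \<kappa>) / (\<alpha> * \<kappa>)"
      using False assms by (auto simp: m_def coupled_exponent_def)
    have "indicator {x. f x > 0} x *\<^sub>R f x powr (1 + m) = Z powr - (1 + m) * (indicator D x * w x)" for x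
    proof (cases "f x > 0")
      case True
      then have x: "x \<in> D" "1 + \<kappa> * y x > 0" by (auto simp: f_pos)
      have "k x = (1 + \<kappa> * y x) powr (- (1 / m))"
        using x False m by (simp add: k_def y_def coupled_kernel_def coupled_exp_def)
      moreover have "- (1 / m) * (1 + m) = - (1 / m) - 1"
        using m(1) by (simp add: field_simps)
      ultimately have "k x powr (1 + m) = (1 + \<kappa> * y x) powr (- (1 / m) - 1)"
        by (simp only: powr_powr)
      also have "\<dots> = w x"
        using x False m by (simp add: w_def escort_kernel_def)
      finally have "k x powr (1 + m) = w x" .
      moreover have "f x powr (1 + m) = k x powr (1 + m) / Z powr (1 + m)"
        using x Z k_nonneg[of x] by (simp add: f_eq powr_divide)
      moreover have "Z powr - (1 + m) = 1 / Z powr (1 + m)"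
        by (rule powr_minus_divide)
      ultimately show ?thesis
        using True x by simp
    next
      case False
      then have "x \<in> D \<Longrightarrow> w x = 0"
        by (simp add: f_pos w_def escort_kernel_eq_0)
      with False show ?thesis by (cases "x \<in> D") auto
    qed
    then have I: "(LINT x:{x. f x > 0}|lborel. f x powr (1 + m)) = Z powr - (1 + m) * W"
      using w_int by (simp add: set_lebesgue_integral_def has_bochner_integral_iff)
    also have "\<dots> = Z powr - m / (1 + \<kappa>)"
    proof -
      have "- (1 + m) = - m - 1" by simp
      then have "Z powr - (1 + m) = Z powr - m / Z"
        using powr_diff[of Z "- m" 1] powr_one[OF less_imp_le[OF Z]] by presburger
      then show ?thesis using W assms Z by (simp add: Z_eq)
    qed
    finally have I: "(LINT x:{x. f x > 0}|lborel. f x powr (1 + m)) = Z powr - m / (1 + \<kappa>)" .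
    have "coupled_avg \<alpha> \<kappa> f = (Z powr - m / (1 + \<kappa>)) powr (1 / m)"
      using coupled_avg_eq_integral_powr[of \<kappa> f \<alpha>] False f_nonneg f_int I Z assms
      by (simp add: m_def has_bochner_integral_iff)
    also have "\<dots> = (1 + \<kappa>) powr - (1 / m) / Z"
    proof -
      have "(Z powr - m) powr (1 / m) = Z powr - 1"
        using m(1) by (simp only: powr_powr) simp
      also have "\<dots> = 1 / Z"
        using Z by (simp add: powr_minus_divide)
      finally have "(Z powr - m) powr (1 / m) = 1 / Z" .
      moreover have "(Z powr - m / (1 + \<kappa>)) powr (1 / m)
          = (Z powr - m) powr (1 / m) / (1 + \<kappa>) powr (1 / m)"
        by (rule powr_divide)
      moreover have "(1 + \<kappa>) powr - (1 / m) = 1 / (1 + \<kappa>) powr (1 / m)"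
        by (rule powr_minus_divide)
      ultimately show ?thesis by simp
    qed
    also have "\<dots> = f (\<mu> + \<sigma>)"
      using False m assms by (simp add: f_at coupled_exp_def)
    finally show ?thesis .
  qed
  then show ?thesis by (simp add: f_def)
qed

end
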